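(* There exist finitely generated torsion-free 2-step nilpotent groups $G$ such that $G$ does not have the $R_\infty$-property, but for every integer $n\geq 2$ the group $G$ has a subgroup of index $n$ which does have the $R_\infty$-property.
   Context: For a group $G$ and $\varphi\in\mathrm{Aut}(G)$, elements $x,y\in G$ are $\varphi$-conjugate if $y=zx\varphi(z)^{-1}$ for some $z\in G$. $G$ has the $R_\infty$-property if for every $\varphi\in\mathrm{Aut}(G)$ the number of $\varphi$-conjugacy classes is infinite. "2-step nilpotent" means nilpotent of class 2. *)

theory Defs
  imports "HOL-Algebra.Algebra"
begin

definition finitely_generated_group :: "('a, 'b) monoid_scheme \<Rightarrow> bool" where
  "finitely_generated_group G \<longleftrightarrow>
     group G \<and> (\<exists>S. finite S \<and> S \<subseteq> carrier G \<and> generate G S = carrier G)"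

definition torsion_free_group :: "('a, 'b) monoid_scheme \<Rightarrow> bool" where
  "torsion_free_group G \<longleftrightarrow>
     group G \<and>
     (\<forall>x\<in>carrier G. \<forall>n::nat. n > 0 \<longrightarrow> x [^]\<^bsub>G\<^esub> n = \<one>\<^bsub>G\<^esub> \<longrightarrow> x = \<one>\<^bsub>G\<^esub>)"

text \<open>The index is shifted by one: \<open>lower_central G k\<close> is usually written
  \<open>\<gamma>\<close> with subscript \<open>k + 1\<close>, where the first term is \<open>G\<close> itself.\<close>

primrec lower_central :: "('a, 'b) monoid_scheme \<Rightarrow> nat \<Rightarrow> 'a set" where
  "lower_central G 0 = carrier G"
| "lower_central G (Suc k) =
     generate G (\<Union>x\<in>lower_central G k. \<Union>y\<in>carrier G.
       {x \<otimes>\<^bsub>G\<^esub> y \<otimes>\<^bsub>G\<^esub> inv\<^bsub>G\<^esub> x \<otimes>\<^bsub>G\<^esub> inv\<^bsub>G\<^esub> y})"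

text \<open>The class is exactly \<open>c\<close>, so abelian groups do not have class 2.\<close>

definition nilpotent_of_class :: "('a, 'b) monoid_scheme \<Rightarrow> nat \<Rightarrow> bool" where
  "nilpotent_of_class G c \<longleftrightarrow>
     group G \<and> lower_central G c = {\<one>\<^bsub>G\<^esub>} \<and> (\<forall>k<c. lower_central G k \<noteq> {\<one>\<^bsub>G\<^esub>})"

definition twisted_conj :: "('a, 'b) monoid_scheme \<Rightarrow> ('a \<Rightarrow> 'a) \<Rightarrow> ('a \<times> 'a) set" where
  "twisted_conj G \<phi> =
     {(x, y). x \<in> carrier G \<and> y \<in> carrier G \<and>
        (\<exists>z\<in>carrier G. y = z \<otimes>\<^bsub>G\<^esub> x \<otimes>\<^bsub>G\<^esub> inv\<^bsub>G\<^esub> (\<phi> z))}"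

definition R_infinity :: "('a, 'b) monoid_scheme \<Rightarrow> bool" where
  "R_infinity G \<longleftrightarrow>
     group G \<and> (\<forall>\<phi>\<in>auto G. infinite (carrier G // twisted_conj G \<phi>))"

lemma (in group) equiv_twisted_conj:
  assumes "\<phi> \<in> auto G"
  shows "equiv (carrier G) (twisted_conj G \<phi>)"
proof -
  have hom: "\<phi> \<in> hom G G"
    using assms by (simp add: auto_def)
  interpret h: group_hom G G \<phi>
    by unfold_locales (rule hom)
  show ?thesis
  proof (rule equivI)
    show "twisted_conj G \<phi> \<subseteq> carrier G \<times> carrier G"
      by (auto simp: twisted_conj_def)
    show "refl_on (carrier G) (twisted_conj G \<phi>)"
      by (auto simp: refl_on_def twisted_conj_def intro!: bexI[of _ "\<one>"])
    show "sym (twisted_conj G \<phi>)"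
    proof (rule symI)
      fix x y assume "(x, y) \<in> twisted_conj G \<phi>"
      then obtain z where z: "x \<in> carrier G" "y \<in> carrier G" "z \<in> carrier G"
        "y = z \<otimes> x \<otimes> inv (\<phi> z)"
        by (auto simp: twisted_conj_def)
      have p: "\<phi> z \<in> carrier G"
        using z(3) by (rule h.hom_closed)
      have "inv z \<otimes> (z \<otimes> x \<otimes> inv (\<phi> z)) \<otimes> \<phi> z = (inv z \<otimes> z) \<otimes> x \<otimes> (inv (\<phi> z) \<otimes> \<phi> z)"
        using z(1,3) p by (simp only: m_assoc m_closed inv_closed)
      also have "\<dots> = x"
        using z(1,3) p by simp
      finally have "x = inv z \<otimes> y \<otimes> inv (\<phi> (inv z))"
        using z(3) p by (simp add: z(4))
      moreover have "inv z \<in> carrier G"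
        using z(3) by simp
      ultimately show "(y, x) \<in> twisted_conj G \<phi>"
        using z(1,2) unfolding twisted_conj_def by blast
    qed
    show "trans (twisted_conj G \<phi>)"
    proof (rule transI)
      fix x y w assume "(x, y) \<in> twisted_conj G \<phi>" "(y, w) \<in> twisted_conj G \<phi>"
      then obtain z u where z: "x \<in> carrier G" "w \<in> carrier G" "z \<in> carrier G" "u \<in> carrier G"
        "w = u \<otimes> (z \<otimes> x \<otimes> inv (\<phi> z)) \<otimes> inv (\<phi> u)"
        by (auto simp: twisted_conj_def)
      have "w = (u \<otimes> z) \<otimes> x \<otimes> inv (\<phi> (u \<otimes> z))"
        using z(1,3,4) by (simp add: z(5) m_assoc inv_mult_group)
      moreover have "u \<otimes> z \<in> carrier G"
        using z(3,4) by simp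
      ultimately show "(x, w) \<in> twisted_conj G \<phi>"
        using z(1,2) unfolding twisted_conj_def by blast
    qed
  qed
qed

end

theory Submission
  imports Defs
begin

text \<open>
  Write a list of nine integers as \<open>(a, b, c, u, z)\<close>, where \<open>a\<close> is an integer and
  \<open>b\<close>, \<open>c\<close>, \<open>u\<close>, \<open>z\<close> are Gaussian integers. The group \<open>\<Gamma>\<close> has centre \<open>{(0, 0, 0, u, z)}\<close>, and
  its commutator pairing sends two elements to \<open>u = a b' - a' b\<close> and \<open>z = b c' - b' c\<close>.
  For a finitely generated torsion-free group of nilpotency class 2, an automorphism has finitely many
  twisted conjugacy classes exactly if it has no eigenvalue 1 on the abelianization modulo
  torsion or on the commutator subgroup. Only instances of this are used, and they are
  proved by hand.

  The group \<open>\<Gamma>\<close> admits the automorphism \<open>(a, b, c, u, z) \<mapsto> (-a, ib, ic, -iu, -z)\<close>, whose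
  eigenvalues are \<open>-1\<close>, \<open>i\<close> and \<open>-i\<close>; so every class has a representative with all entries
  0 or 1 (\<open>not_R_infinity_\<Gamma>\<close>).

  This automorphism has to rotate \<open>b\<close>, and that is destroyed in the subgroup of index \<open>n\<close>
  which requires \<open>n\<close> to divide the imaginary part of \<open>b\<close>. Indeed the pairing is rigid. First,
  an automorphism \<open>\<phi>\<close> of the subgroup preserves the set \<open>b = 0\<close>, because an
  element with \<open>b = 0\<close> commutes with all others of this kind, a group of rank 3 modulo the
  centre, whereas the centralizer of an element with \<open>b \<noteq> 0\<close> has rank at most 2 modulo the
  centre (\<open>bpart_phi_eq_0\<close>). Next, the relation
  \<open>[c, ib] = [ic, b]\<close> forces the action of \<open>\<phi>\<close> on \<open>b\<close> to commute or anticommute with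
  multiplication by \<open>i\<close>. The lattice \<open>\<int> + n i \<int>\<close> has no automorphism of this type except for
  sign changes on the two axes when \<open>n \<ge> 2\<close> (\<open>phi_b_signs\<close>).

  Consequently \<open>\<phi>\<close> acts on the real axis of \<open>b\<close> by a sign \<open>e\<close>, on \<open>a\<close> by a sign \<open>d\<close> modulo the
  other parts (\<open>phi_a_sign\<close>), and on the real axis of \<open>u = [a, b]\<close> by \<open>d * e\<close>. One of \<open>e\<close>, \<open>d\<close>
  and \<open>d * e\<close> is 1. Powers of a basis vector with eigenvalue 1 are pairwise not twisted
  conjugate, as long as 1 is not an eigenvalue in any layer above it; otherwise one takes
  the powers of a basis vector from that higher layer (\<open>infinite_classes\<close>).
\<close>

section \<open>The group\<close>

text \<open>The list is \<open>[a, b\<^sub>1, b\<^sub>2, c\<^sub>1, c\<^sub>2, u\<^sub>1, u\<^sub>2, z\<^sub>1, z\<^sub>2]\<close>, and \<open>a b'\<close> is added to \<open>u\<close>, and the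
  Gaussian product \<open>b c'\<close> to \<open>z\<close>.\<close>

definition gmult :: "int list \<Rightarrow> int list \<Rightarrow> int list" where
  "gmult x y = [x!0 + y!0, x!1 + y!1, x!2 + y!2, x!3 + y!3, x!4 + y!4,
     x!5 + y!5 + x!0 * y!1, x!6 + y!6 + x!0 * y!2,
     x!7 + y!7 + (x!1 * y!3 - x!2 * y!4), x!8 + y!8 + (x!1 * y!4 + x!2 * y!3)]"

definition \<Gamma> :: "int list monoid" where
  "\<Gamma> = \<lparr>carrier = {x. length x = 9}, monoid.mult = gmult, one = [0,0,0,0,0,0,0,0,0]\<rparr>"

lemma carrier_\<Gamma> [simp]: "x \<in> carrier \<Gamma> \<longleftrightarrow> length x = 9"
  by (simp add: \<Gamma>_def)

lemma mult_\<Gamma> [simp]: "x \<otimes>\<^bsub>\<Gamma>\<^esub> y = gmult x y"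
  by (simp add: \<Gamma>_def)

lemma one_\<Gamma>: "\<one>\<^bsub>\<Gamma>\<^esub> = [0,0,0,0,0,0,0,0,0]"
  by (simp add: \<Gamma>_def)

lemma length_gmult [simp]: "length (gmult x y) = 9"
  by (simp add: gmult_def)

lemma gmult_nth [simp]:
  "gmult x y ! 0 = x!0 + y!0" "gmult x y ! (Suc 0) = x!1 + y!1" "gmult x y ! 2 = x!2 + y!2"
  "gmult x y ! 3 = x!3 + y!3" "gmult x y ! 4 = x!4 + y!4"
  "gmult x y ! 5 = x!5 + y!5 + x!0 * y!1" "gmult x y ! 6 = x!6 + y!6 + x!0 * y!2"
  "gmult x y ! 7 = x!7 + y!7 + (x!1 * y!3 - x!2 * y!4)"
  "gmult x y ! 8 = x!8 + y!8 + (x!1 * y!4 + x!2 * y!3)"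
  by (simp_all add: gmult_def)

lemma list9_eqI:
  assumes "length x = 9" "length y = 9" "x!0 = y!0" "x!1 = y!1" "x!2 = y!2" "x!3 = y!3"
    "x!4 = y!4" "x!5 = y!5" "x!6 = y!6" "x!7 = y!7" "x!8 = y!8"
  shows "x = y"
proof (rule nth_equalityI)
  fix i assume "i < length x"
  then have "i \<in> {0,1,2,3,4,5,6,7,8}"
    using assms(1) by auto
  then show "x!i = y!i"
    using assms by auto
qed (simp add: assms)

lemma group_\<Gamma>: "group \<Gamma>"
proof (rule groupI)
  fix x assume "x \<in> carrier \<Gamma>"
  then have "gmult [-x!0, -x!1, -x!2, -x!3, -x!4, x!0 * x!1 - x!5, x!0 * x!2 - x!6,
      x!1 * x!3 - x!2 * x!4 - x!7, x!1 * x!4 + x!2 * x!3 - x!8] x = \<one>\<^bsub>\<Gamma>\<^esub>"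
    by (simp add: one_\<Gamma> gmult_def)
  then show "\<exists>y\<in>carrier \<Gamma>. y \<otimes>\<^bsub>\<Gamma>\<^esub> x = \<one>\<^bsub>\<Gamma>\<^esub>"
    by (intro bexI[where x="[-x!0, -x!1, -x!2, -x!3, -x!4, x!0 * x!1 - x!5, x!0 * x!2 - x!6,
      x!1 * x!3 - x!2 * x!4 - x!7, x!1 * x!4 + x!2 * x!3 - x!8]"]) simp_all
qed (auto simp: one_\<Gamma> algebra_simps intro!: list9_eqI)

interpretation \<Gamma>: group \<Gamma> by (rule group_\<Gamma>)

lemma pow_nth:
  assumes "length x = 9" "i < 5"
  shows "(x [^]\<^bsub>\<Gamma>\<^esub> (k::nat)) ! i = int k * x!i"
proof (induction k)
  case 0
  have "i \<in> {0,1,2,3,4}" using assms(2) by auto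
  then show ?case by (auto simp: one_\<Gamma>)
next
  case (Suc k)
  have "i \<in> {0,1,2,3,4}" using assms(2) by auto
  then show ?case using Suc by (auto simp: algebra_simps)
qed

text \<open>On the centre the cocycle vanishes, so the entries with indices 5 to 8 are additive there too.\<close>
lemma pow_central:
  assumes "length x = 9" "\<And>i. i < 5 \<Longrightarrow> x!i = 0" "i < 9"
  shows "(x [^]\<^bsub>\<Gamma>\<^esub> (k::nat)) ! i = int k * x!i"
proof -
  have i: "i \<in> {0,1,2,3,4,5,6,7,8}" using assms(3) by auto
  have z: "x!0 = 0" "x!1 = 0" "x!2 = 0" "x!3 = 0" "x!4 = 0"
    using assms(2) by simp_all
  show ?thesis
  proof (induction k)
    case 0
    show ?case using i by (auto simp: one_\<Gamma>)
  next
    case (Suc k)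
    show ?case using i z Suc by (auto simp: algebra_simps)
  qed
qed

lemma torsion_free_\<Gamma>: "torsion_free_group \<Gamma>"
  unfolding torsion_free_group_def
proof (intro conjI ballI allI impI)
  fix x and n :: nat assume x: "x \<in> carrier \<Gamma>" and n: "n > 0"
    "x [^]\<^bsub>\<Gamma>\<^esub> n = \<one>\<^bsub>\<Gamma>\<^esub>"
  have l: "length x = 9" using x by simp
  have one: "\<one>\<^bsub>\<Gamma>\<^esub> ! i = 0" if "i < 9" for i
  proof -
    have "i \<in> {0,1,2,3,4,5,6,7,8}" using that by auto
    then show ?thesis by (auto simp: one_\<Gamma>)
  qed
  have z: "x!i = 0" if "i < 5" for i
    using pow_nth[OF l that, of n] n one[of i] that by simp
  have "x!i = 0" if "i < 9" for i
    using pow_central[OF l z that, of n] n one[of i] that by simp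
  then show "x = \<one>\<^bsub>\<Gamma>\<^esub>"
    using l by (intro list9_eqI) (simp_all add: one_\<Gamma>)
qed (rule group_\<Gamma>)

definition axis :: "nat \<Rightarrow> int \<Rightarrow> int list" where
  "axis i k = (replicate 9 0)[i := k]"

lemma length_axis [simp]: "length (axis i k) = 9"
  by (simp add: axis_def)

lemma axis_nth: "i < 9 \<Longrightarrow> j < 9 \<Longrightarrow> axis i k ! j = (if i = j then k else 0)"
  by (simp add: axis_def)

lemma axis_simps [simp]:
  assumes "i < 9"
  shows "axis i k ! 0 = (if i = 0 then k else 0)" "axis i k ! (Suc 0) = (if i = 1 then k else 0)"
    "axis i k ! 2 = (if i = 2 then k else 0)" "axis i k ! 3 = (if i = 3 then k else 0)"
    "axis i k ! 4 = (if i = 4 then k else 0)" "axis i k ! 5 = (if i = 5 then k else 0)"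
    "axis i k ! 6 = (if i = 6 then k else 0)" "axis i k ! 7 = (if i = 7 then k else 0)"
    "axis i k ! 8 = (if i = 8 then k else 0)"
  using assms by (auto simp: axis_nth)

lemma axis_add:
  assumes "i < 9"
  shows "axis i (j + k) = gmult (axis i j) (axis i k)"
  using assms by (intro list9_eqI) auto

text \<open>The order of the factors, \<open>c\<close> before \<open>b\<close> before \<open>a\<close>, makes all cocycle terms \<open>a b'\<close> and \<open>b c'\<close>
  vanish.\<close>
lemma axis_decomposition:
  assumes "length x = 9"
  shows "x = gmult (axis 3 (x!3)) (gmult (axis 4 (x!4)) (gmult (axis 1 (x!1)) (gmult (axis 2 (x!2)) (gmult (axis 0 (x!0))
    (gmult (axis 5 (x!5)) (gmult (axis 6 (x!6)) (gmult (axis 7 (x!7)) (axis 8 (x!8)))))))))"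
  using assms by (intro list9_eqI) auto

lemma finitely_generated_\<Gamma>: "finitely_generated_group \<Gamma>"
proof -
  define S where "S = (\<lambda>i. axis i 1) ` {..<9}"
  have S: "S \<subseteq> carrier \<Gamma>" by (auto simp: S_def)
  interpret M: subgroup "generate \<Gamma> S" \<Gamma>
    by (rule \<Gamma>.generate_is_subgroup[OF S])
  have ax: "axis i k \<in> generate \<Gamma> S" if i: "i < 9" for i k
  proof -
    have nat: "axis i (int m) \<in> generate \<Gamma> S" for m
    proof (induction m)
      case 0
      have "axis i 0 = \<one>\<^bsub>\<Gamma>\<^esub>" using i by (intro list9_eqI) (auto simp: one_\<Gamma>)
      then show ?case by simp
    next
      case (Suc m)
      have "axis i 1 \<in> generate \<Gamma> S"
        using i by (intro generate.incl) (auto simp: S_def)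
      from M.m_closed[OF this Suc] show ?case
        by (simp add: axis_add[OF i, symmetric])
    qed
    show ?thesis
    proof (cases "k \<ge> 0")
      case True
      then show ?thesis using nat[of "nat k"] by simp
    next
      case False
      have "axis i k \<otimes>\<^bsub>\<Gamma>\<^esub> axis i (- k) = \<one>\<^bsub>\<Gamma>\<^esub>"
        using i by (intro list9_eqI) (auto simp: one_\<Gamma>)
      then have "axis i k = inv\<^bsub>\<Gamma>\<^esub> (axis i (- k))"
        by (intro \<Gamma>.inv_equality[symmetric]) auto
      then show ?thesis using M.m_inv_closed[OF nat[of "nat (- k)"]] False by simp
    qed
  qed
  have "x \<in> generate \<Gamma> S" if "x \<in> carrier \<Gamma>" for x
  proof -
    have cl: "gmult y z \<in> generate \<Gamma> S" if "y \<in> generate \<Gamma> S" "z \<in> generate \<Gamma> S" for y z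
      using M.m_closed[OF that] by simp
    show ?thesis
    proof (rule ssubst[OF axis_decomposition, where P = "\<lambda>y. y \<in> generate \<Gamma> S"])
      show "length x = 9" using that by simp
    qed (intro cl ax; simp)
  qed
  then have "generate \<Gamma> S = carrier \<Gamma>"
    using M.subset by blast
  moreover have "finite S" by (simp add: S_def)
  ultimately show ?thesis
    unfolding finitely_generated_group_def using S group_\<Gamma> by blast
qed

section \<open>Commutators and nilpotency\<close>
definition bracket :: "int list \<Rightarrow> int list \<Rightarrow> int list" where
  "bracket x y = [0, 0, 0, 0, 0, x!0 * y!1 - y!0 * x!1, x!0 * y!2 - y!0 * x!2,
     x!1 * y!3 - x!2 * y!4 - (y!1 * x!3 - y!2 * x!4),
     x!1 * y!4 + x!2 * y!3 - (y!1 * x!4 + y!2 * x!3)]"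

lemma length_bracket [simp]: "length (bracket x y) = 9"
  by (simp add: bracket_def)

lemma gmult_bracket: "gmult x y = gmult (bracket x y) (gmult y x)"
  by (rule list9_eqI) (simp_all add: bracket_def)

lemma commutator_\<Gamma>:
  assumes "length x = 9" "length y = 9"
  shows "x \<otimes>\<^bsub>\<Gamma>\<^esub> y \<otimes>\<^bsub>\<Gamma>\<^esub> inv\<^bsub>\<Gamma>\<^esub> x \<otimes>\<^bsub>\<Gamma>\<^esub> inv\<^bsub>\<Gamma>\<^esub> y = bracket x y"
proof -
  have c: "x \<in> carrier \<Gamma>" "y \<in> carrier \<Gamma>" "bracket x y \<in> carrier \<Gamma>" using assms by auto
  have "x \<otimes>\<^bsub>\<Gamma>\<^esub> y = bracket x y \<otimes>\<^bsub>\<Gamma>\<^esub> (y \<otimes>\<^bsub>\<Gamma>\<^esub> x)"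
    using gmult_bracket by simp
  then have "x \<otimes>\<^bsub>\<Gamma>\<^esub> y \<otimes>\<^bsub>\<Gamma>\<^esub> inv\<^bsub>\<Gamma>\<^esub> (y \<otimes>\<^bsub>\<Gamma>\<^esub> x) = bracket x y"
    using c by (metis \<Gamma>.inv_solve_right \<Gamma>.m_closed)
  then show ?thesis
    using c by (simp add: \<Gamma>.inv_mult_group \<Gamma>.m_assoc del: mult_\<Gamma> carrier_\<Gamma>)
qed

lemma nilpotent_\<Gamma>: "nilpotent_of_class \<Gamma> 2"
proof -
  define W where "W = {x :: int list. length x = 9 \<and> x!0 = 0 \<and> x!1 = 0 \<and> x!2 = 0 \<and> x!3 = 0 \<and> x!4 = 0}"
  have W: "subgroup W \<Gamma>"
  proof (rule \<Gamma>.subgroupI)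
    fix x assume "x \<in> W"
    then have "inv\<^bsub>\<Gamma>\<^esub> x = map uminus x"
      by (intro \<Gamma>.inv_equality list9_eqI) (auto simp: W_def one_\<Gamma>)
    then show "inv\<^bsub>\<Gamma>\<^esub> x \<in> W" using \<open>x \<in> W\<close> by (auto simp: W_def)
  next
    show "W \<noteq> {}"
    proof -
      have "replicate 9 0 \<in> W" by (simp add: W_def)
      then show ?thesis by blast
    qed
  qed (auto simp: W_def)
  have one: "lower_central \<Gamma> 1 = generate \<Gamma> (\<Union>x\<in>carrier \<Gamma>. \<Union>y\<in>carrier \<Gamma>. {bracket x y})"
    by (simp add: commutator_\<Gamma> del: mult_\<Gamma>)
  have sub: "lower_central \<Gamma> 1 \<subseteq> W"
    unfolding one by (rule \<Gamma>.generate_subgroup_incl[OF _ W]) (auto simp: W_def bracket_def)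
  have "lower_central \<Gamma> 2 \<subseteq> {\<one>\<^bsub>\<Gamma>\<^esub>}"
  proof -
    have "x \<otimes>\<^bsub>\<Gamma>\<^esub> y \<otimes>\<^bsub>\<Gamma>\<^esub> inv\<^bsub>\<Gamma>\<^esub> x \<otimes>\<^bsub>\<Gamma>\<^esub> inv\<^bsub>\<Gamma>\<^esub> y = \<one>\<^bsub>\<Gamma>\<^esub>"
      if "x \<in> lower_central \<Gamma> 1" "y \<in> carrier \<Gamma>" for x y
    proof -
      have "x \<in> W" using that sub by blast
      then show ?thesis using that(2)
        by (subst commutator_\<Gamma>) (auto simp: W_def bracket_def one_\<Gamma>)
    qed
    then have "(\<Union>x\<in>lower_central \<Gamma> 1. \<Union>y\<in>carrier \<Gamma>.
       {x \<otimes>\<^bsub>\<Gamma>\<^esub> y \<otimes>\<^bsub>\<Gamma>\<^esub> inv\<^bsub>\<Gamma>\<^esub> x \<otimes>\<^bsub>\<Gamma>\<^esub> inv\<^bsub>\<Gamma>\<^esub> y}) \<subseteq> {\<one>\<^bsub>\<Gamma>\<^esub>}"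
      by blast
    then show ?thesis
      unfolding numeral_2_eq_2 lower_central.simps(2)[of _ "Suc 0"] One_nat_def
      by (rule \<Gamma>.generate_subgroup_incl[OF _ \<Gamma>.triv_subgroup])
  qed
  moreover have "\<one>\<^bsub>\<Gamma>\<^esub> \<in> lower_central \<Gamma> 2"
    by (simp only: numeral_2_eq_2 lower_central.simps(2)) (rule generate.one)
  moreover have "lower_central \<Gamma> 1 \<noteq> {\<one>\<^bsub>\<Gamma>\<^esub>}"
  proof -
    have "bracket (axis 0 1) (axis 1 1) \<in> lower_central \<Gamma> 1"
      unfolding one by (rule generate.incl) (auto intro!: bexI)
    moreover have "bracket (axis 0 1) (axis 1 1) \<noteq> \<one>\<^bsub>\<Gamma>\<^esub>"
      by (simp add: bracket_def one_\<Gamma>)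
    ultimately show ?thesis by blast
  qed
  moreover have "lower_central \<Gamma> 0 \<noteq> {\<one>\<^bsub>\<Gamma>\<^esub>}"
  proof -
    have "axis 0 1 \<in> lower_central \<Gamma> 0" "axis 0 1 \<noteq> \<one>\<^bsub>\<Gamma>\<^esub>"
      by (simp_all add: one_\<Gamma> axis_def numeral_eq_Suc)
    then show ?thesis by blast
  qed
  ultimately show ?thesis
    unfolding nilpotent_of_class_def using group_\<Gamma> by (auto simp: less_2_cases_iff)
qed

section \<open>An automorphism with finitely many twisted conjugacy classes\<close>
lemma (in group) twisted_conj_iff:
  assumes "\<phi> \<in> auto G"
  shows "(x, y) \<in> twisted_conj G \<phi> \<longleftrightarrow>
    x \<in> carrier G \<and> y \<in> carrier G \<and> (\<exists>z\<in>carrier G. y \<otimes> \<phi> z = z \<otimes> x)"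
proof -
  have "\<phi> z \<in> carrier G" if "z \<in> carrier G" for z
    using assms that by (auto simp: auto_def hom_def)
  then have "y = z \<otimes> x \<otimes> inv (\<phi> z) \<longleftrightarrow> y \<otimes> \<phi> z = z \<otimes> x"
    if "x \<in> carrier G" "y \<in> carrier G" "z \<in> carrier G" for z
    using that by (metis inv_solve_right m_closed)
  then show ?thesis
    unfolding twisted_conj_def by blast
qed

text \<open>The automorphism is multiplication by \<open>i\<close> on \<open>b\<close> and \<open>c\<close> and by \<open>-1\<close> on \<open>a\<close>. The products
  \<open>u = a b\<close> and \<open>z = b c\<close> are then multiplied by \<open>-i\<close> and by \<open>i\<^sup>2 = -1\<close>.\<close>
definition twist :: "int list \<Rightarrow> int list" where
  "twist x = [- x!0, - x!2, x!1, - x!4, x!3, x!6, - x!5, - x!7, - x!8]"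

lemma twist_auto: "restrict twist (carrier \<Gamma>) \<in> auto \<Gamma>"
proof -
  have "bij_betw twist (carrier \<Gamma>) (carrier \<Gamma>)"
    by (rule bij_betw_byWitness[where f' =
      "\<lambda>x. [- x!0, x!2, - x!1, x!4, - x!3, - x!6, x!5, - x!7, - x!8]"])
      (auto simp: twist_def intro!: list9_eqI)
  then have "restrict twist (carrier \<Gamma>) \<in> Bij (carrier \<Gamma>)"
    by (simp add: Bij_def)
  moreover have "twist (gmult x y) = gmult (twist x) (twist y)" for x y
    by (rule list9_eqI) (simp_all add: twist_def algebra_simps)
  then have "restrict twist (carrier \<Gamma>) \<in> hom \<Gamma> \<Gamma>"
    by (auto simp: hom_def) (simp_all add: twist_def)
  ultimately show ?thesis by (simp add: auto_def)
qed

lemma half_reduce: "\<exists>k r. r \<in> {0, 1::int} \<and> r = t + 2 * k"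
  by (rule exI[of _ "- (t div 2)"], rule exI[of _ "t mod 2"]) (auto simp: minus_div_mult_eq_mod [symmetric])

text \<open>The ideal generated by \<open>1 - i\<close> has index 2 in the Gaussian integers; here
  \<open>(1 - i) * (p + q i) = (p + q) + (q - p) i\<close>.\<close>
lemma gauss_reduce: "\<exists>p q r. r \<in> {0, 1::int} \<and> s + p + q = r \<and> t + q - p = 0"
proof -
  obtain k r where "r \<in> {0, 1::int}" "r = s + t + 2 * k" using half_reduce by blast
  then show ?thesis by (intro exI[of _ "t + k"] exI[of _ k] exI[of _ r]) auto
qed

text \<open>Passing from \<open>x\<close> to a twisted conjugate changes \<open>a\<close> and \<open>z\<close> by multiples of 2, and \<open>b\<close> and \<open>c\<close>
  by multiples of \<open>1 - i\<close>, and \<open>u\<close> by multiples of \<open>1 + i\<close>, up to terms from the coordinates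
  treated earlier. All these ideals have finite index.\<close>
lemma not_R_infinity_\<Gamma>: "\<not> R_infinity \<Gamma>"
proof -
  define \<phi> where "\<phi> = restrict twist (carrier \<Gamma>)"
  define F where "F = {r :: int list. set r \<subseteq> {0, 1} \<and> length r = 9}"
  have aut: "\<phi> \<in> auto \<Gamma>" by (simp add: \<phi>_def twist_auto)
  have red: "\<exists>r\<in>F. (r, x) \<in> twisted_conj \<Gamma> \<phi>" if x: "x \<in> carrier \<Gamma>" for x
  proof -
    obtain z0 r0 where 0: "r0 \<in> {0, 1::int}" "r0 = x!0 + 2 * z0"
      using half_reduce[of "x!0"] by metis
    obtain z1 z2 r1 where 1: "r1 \<in> {0, 1::int}" "x!1 + z1 + z2 = r1" "x!2 + z2 - z1 = 0"
      using gauss_reduce[of "x!1" "x!2"] by metis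
    obtain z3 z4 r3 where 3: "r3 \<in> {0, 1::int}" "x!3 + z3 + z4 = r3" "x!4 + z4 - z3 = 0"
      using gauss_reduce[of "x!3" "x!4"] by metis
    \<comment> \<open>Since \<open>1 + i = i * (1 - i)\<close>, the reduction of \<open>u\<close> is the one for \<open>1 - i\<close> with real and
      imaginary parts exchanged. The additional terms are the cocycles of the two products
      that are compared.\<close>
    obtain z6 z5 r6 where 5: "r6 \<in> {0, 1::int}" "(x!6 + z0 * x!2 - r0 * z1) + z6 + z5 = r6"
      "(x!5 + z0 * x!1 + r0 * z2) + z5 - z6 = 0"
      using gauss_reduce[of "x!6 + z0 * x!2 - r0 * z1" "x!5 + z0 * x!1 + r0 * z2"] by metis
    obtain z7 r7 where 7: "r7 \<in> {0, 1::int}"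
      "r7 = (x!7 + (z1 * x!3 - z2 * x!4) + r1 * z4) + 2 * z7"
      using half_reduce[of "x!7 + (z1 * x!3 - z2 * x!4) + r1 * z4"] by metis
    obtain z8 r8 where 8: "r8 \<in> {0, 1::int}"
      "r8 = (x!8 + (z1 * x!4 + z2 * x!3) - r1 * z3) + 2 * z8"
      using half_reduce[of "x!8 + (z1 * x!4 + z2 * x!3) - r1 * z3"] by metis
    define z where "z = [z0,z1,z2,z3,z4,z5,z6,z7,z8]"
    define r where "r = [r0,r1,0,r3,0,0,r6,r7,r8]"
    have "gmult r (twist z) = gmult z x"
      using 0 1 3 5 7 8 by (intro list9_eqI) (simp_all add: z_def r_def twist_def)
    moreover have "r \<in> F" using 0 1 3 5 7 8 by (simp add: F_def r_def)
    moreover have "z \<in> carrier \<Gamma>" "r \<in> carrier \<Gamma>" by (simp_all add: z_def r_def)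
    moreover have "\<phi> z = twist z" by (simp add: \<phi>_def z_def)
    ultimately have "(x, r) \<in> twisted_conj \<Gamma> \<phi>" "r \<in> F"
      using x by (auto simp: \<Gamma>.twisted_conj_iff[OF aut] intro!: bexI[of _ z])
    then show ?thesis
      using \<Gamma>.equiv_twisted_conj[OF aut] by (meson equivE symD)
  qed
  have "\<exists>r\<in>F. twisted_conj \<Gamma> \<phi> `` {x} = twisted_conj \<Gamma> \<phi> `` {r}" if "x \<in> carrier \<Gamma>" for x
    using red[OF that] equiv_class_eq[OF \<Gamma>.equiv_twisted_conj[OF aut]] by metis
  then have "carrier \<Gamma> // twisted_conj \<Gamma> \<phi> \<subseteq> (\<lambda>r. twisted_conj \<Gamma> \<phi> `` {r}) ` F"
    unfolding quotient_def by blast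
  moreover have "finite F"
    unfolding F_def by (rule finite_lists_length_eq) simp
  ultimately have "finite (carrier \<Gamma> // twisted_conj \<Gamma> \<phi>)"
    using finite_subset by blast
  then show ?thesis
    unfolding R_infinity_def using aut by blast
qed

section \<open>The subgroup of index \<open>n\<close>\<close>
definition \<Gamma>_sub :: "nat \<Rightarrow> int list set" where
  "\<Gamma>_sub n = {x. length x = 9 \<and> int n dvd x!2}"

lemma index_\<Gamma>_sub:
  assumes "n \<ge> 1"
  shows "subgroup (\<Gamma>_sub n) \<Gamma>" "card (rcosets\<^bsub>\<Gamma>\<^esub> (\<Gamma>_sub n)) = n"
proof -
  let ?Z = "integer_mod_group n"
  define h where "h = (\<lambda>x :: int list. x!2 mod int n)"
  interpret h: group_hom \<Gamma> ?Z h
  proof (intro group_hom.intro group_hom_axioms.intro group_\<Gamma> group_integer_mod_group)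
    show "h \<in> hom \<Gamma> ?Z"
      using assms by (auto simp: hom_def h_def integer_mod_group_def integer_group_def mod_add_eq)
  qed
  have k: "kernel \<Gamma> ?Z h = \<Gamma>_sub n"
    using assms by (auto simp: kernel_def \<Gamma>_sub_def h_def dvd_eq_mod_eq_0)
  show "subgroup (\<Gamma>_sub n) \<Gamma>"
    using h.subgroup_kernel k by simp
  have "h ` carrier \<Gamma> \<subseteq> carrier ?Z"
    using h.hom_closed by blast
  moreover have "carrier ?Z \<subseteq> h ` carrier \<Gamma>"
  proof
    fix k assume "k \<in> carrier ?Z"
    then have "h (axis 2 k) = k"
      using assms by (auto simp: h_def carrier_integer_mod_group)
    then show "k \<in> h ` carrier \<Gamma>" by (metis carrier_\<Gamma> imageI length_axis)
  qed
  ultimately have "h ` carrier \<Gamma> = carrier ?Z" ..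
  then have "(\<Gamma> Mod \<Gamma>_sub n) \<cong> ?Z"
    using h.FactGroup_iso k by simp
  then have "card (carrier (\<Gamma> Mod \<Gamma>_sub n)) = card (carrier ?Z)"
    using iso_same_card by blast
  then show "card (rcosets\<^bsub>\<Gamma>\<^esub> (\<Gamma>_sub n)) = n"
    using assms by (simp add: FactGroup_def carrier_integer_mod_group)
qed

section \<open>Gaussian coordinates\<close>
definition apart :: "int list \<Rightarrow> complex" where "apart x = of_int (x!0)"
definition bpart :: "int list \<Rightarrow> complex" where "bpart x = Complex (of_int (x!1)) (of_int (x!2))"
definition cpart :: "int list \<Rightarrow> complex" where "cpart x = Complex (of_int (x!3)) (of_int (x!4))"

lemma parts_gmult [simp]:
  "apart (gmult x y) = apart x + apart y" "bpart (gmult x y) = bpart x + bpart y" "cpart (gmult x y) = cpart x + cpart y"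
  by (simp_all add: apart_def bpart_def cpart_def complex_eq_iff)

lemma bpart_eq_0_iff: "bpart x = 0 \<longleftrightarrow> x!1 = 0 \<and> x!2 = 0"
  by (simp add: bpart_def complex_eq_iff)

lemma cpart_eq_0_iff: "cpart x = 0 \<longleftrightarrow> x!3 = 0 \<and> x!4 = 0"
  by (simp add: cpart_def complex_eq_iff)

lemma apart_eq_0_iff: "apart x = 0 \<longleftrightarrow> x!0 = 0"
  by (simp add: apart_def)

lemma axis_parts [simp]:
  "apart (axis 0 k) = of_int k" "bpart (axis 0 k) = 0" "cpart (axis 0 k) = 0"
  "apart (axis (Suc 0) k) = 0" "bpart (axis (Suc 0) k) = of_int k" "cpart (axis (Suc 0) k) = 0"
  "apart (axis 2 k) = 0" "bpart (axis 2 k) = \<i> * of_int k" "cpart (axis 2 k) = 0"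
  "apart (axis 3 k) = 0" "bpart (axis 3 k) = 0" "cpart (axis 3 k) = of_int k"
  "apart (axis 4 k) = 0" "bpart (axis 4 k) = 0" "cpart (axis 4 k) = \<i> * of_int k"
  by (simp_all add: apart_def bpart_def cpart_def complex_eq_iff)

definition central :: "int list \<Rightarrow> bool" where
  "central x \<longleftrightarrow> apart x = 0 \<and> bpart x = 0 \<and> cpart x = 0"
lemma bracket_eq_iff:
  "bracket x y = bracket x' y' \<longleftrightarrow>
    apart x * bpart y - apart y * bpart x = apart x' * bpart y' - apart y' * bpart x' \<and>
    bpart x * cpart y - bpart y * cpart x = bpart x' * cpart y' - bpart y' * cpart x'"
  unfolding bracket_def apart_def bpart_def cpart_def complex_eq_iff
  by (simp flip: of_int_mult of_int_diff of_int_add add: algebra_simps)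

lemma bracket_eq_one_iff:
  "bracket x y = \<one>\<^bsub>\<Gamma>\<^esub> \<longleftrightarrow> apart x * bpart y = apart y * bpart x \<and> bpart x * cpart y = bpart y * cpart x"
  unfolding bracket_def apart_def bpart_def cpart_def complex_eq_iff one_\<Gamma>
  by (simp flip: of_int_mult of_int_diff of_int_add add: algebra_simps)

lemma additive_int:
  fixes g :: "int \<Rightarrow> 'b::ring_1"
  assumes "\<And>j k. g (j + k) = g j + g k"
  shows "g k = of_int k * g 1"
proof (induction k rule: int_induct[where k = 0])
  case base
  show ?case using assms[of 0 0] by simp
next
  case (step1 i)
  then show ?case using assms[of i 1] by (simp add: algebra_simps)
next
  case (step2 i)
  then show ?case using assms[of "i - 1" 1] by (simp add: algebra_simps)
qed

text \<open>The coefficients are the cross product of the two rows. If it vanishes, the first two vectors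
  are already parallel.\<close>
lemma three_vectors_dependent:
  fixes x1 x2 x3 y1 y2 y3 :: int
  shows "\<exists>k1 k2 k3. (k1, k2, k3) \<noteq> (0, 0, 0) \<and> k1 * x1 + k2 * x2 + k3 * x3 = 0 \<and>
    k1 * y1 + k2 * y2 + k3 * y3 = 0"
proof (cases "(x2 * y3 - x3 * y2, x3 * y1 - x1 * y3, x1 * y2 - x2 * y1) = (0, 0, 0)")
  case False
  then show ?thesis
    by (intro exI[of _ "x2 * y3 - x3 * y2"] exI[of _ "x3 * y1 - x1 * y3"] exI[of _ "x1 * y2 - x2 * y1"])
      (simp add: algebra_simps)
next
  case True
  then have par: "x1 * y2 = x2 * y1" by simp
  consider "x1 = 0" "y1 = 0" | "x1 \<noteq> 0" | "y1 \<noteq> 0" by blast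
  then show ?thesis
  proof cases
    case 1
    then show ?thesis by (intro exI[of _ 1] exI[of _ 0]) simp
  next
    case 2
    then show ?thesis using par
      by (intro exI[of _ x2] exI[of _ "- x1"] exI[of _ 0]) simp
  next
    case 3
    then show ?thesis using par
      by (intro exI[of _ y2] exI[of _ "- y1"] exI[of _ 0]) (simp add: algebra_simps)
  qed
qed

lemma \<Gamma>_sub_iff: "x \<in> \<Gamma>_sub n \<longleftrightarrow> length x = 9 \<and> int n dvd x!2"
  by (simp add: \<Gamma>_sub_def)

lemma gmult_in_sub: "x \<in> \<Gamma>_sub n \<Longrightarrow> y \<in> \<Gamma>_sub n \<Longrightarrow> gmult x y \<in> \<Gamma>_sub n"
  by (simp add: \<Gamma>_sub_iff)

lemma axis_in_sub: "i < 9 \<Longrightarrow> i \<noteq> 2 \<Longrightarrow> axis i k \<in> \<Gamma>_sub n"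
  by (simp add: \<Gamma>_sub_iff)

lemma axis2_in_sub: "axis 2 (int n * k) \<in> \<Gamma>_sub n"
  by (simp add: \<Gamma>_sub_iff)

text \<open>A homomorphism that kills the centre is determined by its values on the basis \<open>1\<close>, \<open>n i\<close> of the
  \<open>b\<close>-lattice and on the basis vectors of \<open>a\<close> and \<open>c\<close>.\<close>
lemma additive_on_sub:
  fixes f :: "int list \<Rightarrow> complex"
  assumes "n \<ge> 1" and add: "\<And>x y. x \<in> \<Gamma>_sub n \<Longrightarrow> y \<in> \<Gamma>_sub n \<Longrightarrow> f (gmult x y) = f x + f y"
    and cen: "\<And>x. x \<in> \<Gamma>_sub n \<Longrightarrow> central x \<Longrightarrow> f x = 0"
    and x: "x \<in> \<Gamma>_sub n"
  shows "f x = of_int (x!0) * f (axis 0 1) + of_int (x!1) * f (axis 1 1) +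
    of_int (x!2 div int n) * f (axis 2 (int n)) + of_int (x!3) * f (axis 3 1) + of_int (x!4) * f (axis 4 1)"
proof -
  have ax: "f (axis i k) = of_int k * f (axis i 1)" if "i < 9" "i \<noteq> 2" for i k
    by (rule additive_int) (simp add: axis_add that add axis_in_sub)
  have ax2: "f (axis 2 (int n * k)) = of_int k * f (axis 2 (int n * 1))" for k
    by (rule additive_int) (simp add: axis_add add axis2_in_sub distrib_left)
  have x2: "x!2 = int n * (x!2 div int n)" and l: "length x = 9"
    using x by (simp_all add: \<Gamma>_sub_iff)
  define w where "w = gmult (axis 5 (x!5)) (gmult (axis 6 (x!6)) (gmult (axis 7 (x!7)) (axis 8 (x!8))))"
  have w: "w \<in> \<Gamma>_sub n"
    by (simp add: w_def \<Gamma>_sub_iff)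
  moreover have "central w"
    by (simp add: central_def w_def apart_def bpart_def cpart_def complex_eq_iff)
  ultimately have fw: "f w = 0"
    by (rule cen)
  have "x = gmult (axis 3 (x!3)) (gmult (axis 4 (x!4)) (gmult (axis 1 (x!1))
      (gmult (axis 2 (int n * (x!2 div int n))) (gmult (axis 0 (x!0)) w))))"
    using axis_decomposition[OF l] x2 unfolding w_def by simp
  then have "f x = f (gmult (axis 3 (x!3)) (gmult (axis 4 (x!4)) (gmult (axis 1 (x!1))
      (gmult (axis 2 (int n * (x!2 div int n))) (gmult (axis 0 (x!0)) w)))))"
    by (rule arg_cong)
  also have "\<dots> = f (axis 3 (x!3)) + (f (axis 4 (x!4)) + (f (axis 1 (x!1)) +
      (f (axis 2 (int n * (x!2 div int n))) + (f (axis 0 (x!0)) + f w))))"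
    by (simp only: add gmult_in_sub axis_in_sub axis2_in_sub w)
  also have "\<dots> = of_int (x!3) * f (axis 3 1) + (of_int (x!4) * f (axis 4 1) + (of_int (x!1) * f (axis 1 1) +
      (of_int (x!2 div int n) * f (axis 2 (int n)) + (of_int (x!0) * f (axis 0 1) + 0))))"
    using ax[of 3 "x!3"] ax[of 4 "x!4"] ax[of 1 "x!1"] ax2[of "x!2 div int n"] ax[of 0 "x!0"] fw by simp
  finally show ?thesis by simp
qed

lemma infinite_quotientI:
  fixes x :: "nat \<Rightarrow> 'a"
  assumes eq: "equiv S r" and x: "\<And>k. x k \<in> S" and ne: "\<And>k l. (x k, x l) \<in> r \<Longrightarrow> k = l"
  shows "infinite (S // r)"
proof -
  have "inj (\<lambda>k. r `` {x k})"
    by (rule injI) (metis eq_equiv_class[OF _ eq x] ne)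
  then have "infinite (range (\<lambda>k. r `` {x k}))"
    by (rule range_inj_infinite)
  moreover have "range (\<lambda>k. r `` {x k}) \<subseteq> S // r"
    using x by (auto intro: quotientI)
  ultimately show ?thesis
    using finite_subset by blast
qed

section \<open>Rigidity of automorphisms of the subgroup\<close>
locale \<Gamma>_sub_automorphism =
  fixes n :: nat and \<phi>
  assumes n: "n \<ge> 2" and aut: "\<phi> \<in> auto (\<Gamma>\<lparr>carrier := \<Gamma>_sub n\<rparr>)"
begin

lemma closed: "x \<in> \<Gamma>_sub n \<Longrightarrow> \<phi> x \<in> \<Gamma>_sub n"
  and phi_gmult: "x \<in> \<Gamma>_sub n \<Longrightarrow> y \<in> \<Gamma>_sub n \<Longrightarrow> \<phi> (gmult x y) = gmult (\<phi> x) (\<phi> y)"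
  and bij: "bij_betw \<phi> (\<Gamma>_sub n) (\<Gamma>_sub n)"
  using aut by (auto simp: auto_def hom_def Bij_def Pi_def)

lemma len: "x \<in> \<Gamma>_sub n \<Longrightarrow> length x = 9"
  by (simp add: \<Gamma>_sub_iff)

lemma bracket_in_sub: "bracket x y \<in> \<Gamma>_sub n"
  by (simp add: \<Gamma>_sub_iff bracket_def)

lemma phi_bracket:
  assumes "x \<in> \<Gamma>_sub n" "y \<in> \<Gamma>_sub n"
  shows "\<phi> (bracket x y) = bracket (\<phi> x) (\<phi> y)"
proof -
  have "gmult (\<phi> (bracket x y)) (\<phi> (gmult y x)) = \<phi> (gmult x y)"
    using assms by (simp add: phi_gmult[symmetric] bracket_in_sub gmult_in_sub gmult_bracket[symmetric])
  also have "\<dots> = gmult (bracket (\<phi> x) (\<phi> y)) (\<phi> (gmult y x))"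
    using assms by (simp add: phi_gmult gmult_bracket[symmetric])
  finally show ?thesis
    using \<Gamma>.r_cancel[of "\<phi> (bracket x y)" "\<phi> (gmult y x)" "bracket (\<phi> x) (\<phi> y)"] assms
    by (simp add: len closed bracket_in_sub gmult_in_sub)
qed

lemma phi_one: "\<phi> \<one>\<^bsub>\<Gamma>\<^esub> = \<one>\<^bsub>\<Gamma>\<^esub>"
proof -
  have "\<one>\<^bsub>\<Gamma>\<^esub> = bracket \<one>\<^bsub>\<Gamma>\<^esub> \<one>\<^bsub>\<Gamma>\<^esub>" by (simp add: one_\<Gamma> bracket_def)
  moreover have "bracket x x = \<one>\<^bsub>\<Gamma>\<^esub>" for x by (simp add: one_\<Gamma> bracket_def)
  moreover have "\<one>\<^bsub>\<Gamma>\<^esub> \<in> \<Gamma>_sub n" by (simp add: \<Gamma>_sub_iff one_\<Gamma>)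
  ultimately show ?thesis by (metis phi_bracket)
qed

lemma bracket_phi_eq_one_iff:
  assumes "x \<in> \<Gamma>_sub n" "y \<in> \<Gamma>_sub n"
  shows "bracket (\<phi> x) (\<phi> y) = \<one>\<^bsub>\<Gamma>\<^esub> \<longleftrightarrow> bracket x y = \<one>\<^bsub>\<Gamma>\<^esub>"
proof -
  have "\<one>\<^bsub>\<Gamma>\<^esub> \<in> \<Gamma>_sub n" by (simp add: \<Gamma>_sub_iff one_\<Gamma>)
  then have "\<phi> (bracket x y) = \<phi> \<one>\<^bsub>\<Gamma>\<^esub> \<longleftrightarrow> bracket x y = \<one>\<^bsub>\<Gamma>\<^esub>"
    using bij bracket_in_sub by (auto simp: bij_betw_def inj_on_def)
  then show ?thesis using assms by (simp add: phi_bracket phi_one)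
qed

lemma central_iff:
  "central x \<longleftrightarrow> (\<forall>y\<in>\<Gamma>_sub n. bracket x y = \<one>\<^bsub>\<Gamma>\<^esub>)"
proof
  assume "\<forall>y\<in>\<Gamma>_sub n. bracket x y = \<one>\<^bsub>\<Gamma>\<^esub>"
  then have "bracket x (axis 0 1) = \<one>\<^bsub>\<Gamma>\<^esub>" "bracket x (axis 1 1) = \<one>\<^bsub>\<Gamma>\<^esub>"
    by (simp_all add: axis_in_sub)
  then show "central x" by (simp add: bracket_eq_one_iff central_def)
qed (simp add: bracket_eq_one_iff central_def)

text \<open>The elements with \<open>a = b = c = 0\<close> are the centre of the subgroup, hence characteristic.\<close>
lemma central_phi_iff:
  assumes "x \<in> \<Gamma>_sub n"
  shows "central (\<phi> x) \<longleftrightarrow> central x"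
proof -
  have "central (\<phi> x) \<longleftrightarrow> (\<forall>y\<in>\<phi> ` \<Gamma>_sub n. bracket (\<phi> x) y = \<one>\<^bsub>\<Gamma>\<^esub>)"
    using bij by (simp add: central_iff bij_betw_def)
  also have "\<dots> \<longleftrightarrow> central x"
    using assms by (simp add: central_iff bracket_phi_eq_one_iff)
  finally show ?thesis .
qed

lemma phi_linear:
  assumes f: "f \<in> {apart, bpart, cpart}" and x: "x \<in> \<Gamma>_sub n"
  shows "f (\<phi> x) = of_int (x!0) * f (\<phi> (axis 0 1)) + of_int (x!1) * f (\<phi> (axis 1 1)) +
    of_int (x!2 div int n) * f (\<phi> (axis 2 (int n))) + of_int (x!3) * f (\<phi> (axis 3 1)) +
    of_int (x!4) * f (\<phi> (axis 4 1))"
proof (rule additive_on_sub[where f = "\<lambda>x. f (\<phi> x)"])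
  show "f (\<phi> (gmult x y)) = f (\<phi> x) + f (\<phi> y)" if "x \<in> \<Gamma>_sub n" "y \<in> \<Gamma>_sub n" for x y
    using f that by (auto simp: phi_gmult)
  show "f (\<phi> x) = 0" if "x \<in> \<Gamma>_sub n" "central x" for x
    using f central_phi_iff[OF that(1)] that by (auto simp: central_def)
qed (use n x in auto)

text \<open>If the image \<open>y\<close> of \<open>x\<close> had nonzero \<open>b\<close>, an element of the centralizer of \<open>y\<close> would be determined
  modulo the centre by its own \<open>b\<close>, so that the centralizer would have rank at most 2 modulo the
  centre. But \<open>x\<close> commutes with the basis vectors of \<open>a\<close> and \<open>c\<close>, which are three
  independent elements.\<close>
lemma bpart_phi_eq_0:
  assumes x: "x \<in> \<Gamma>_sub n" "bpart x = 0"
  shows "bpart (\<phi> x) = 0"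
proof (rule ccontr)
  assume y: "bpart (\<phi> x) \<noteq> 0"
  obtain k0 k3 k4 where k: "(k0, k3, k4) \<noteq> (0, 0, 0)"
    "k0 * \<phi> (axis 0 1) ! 1 + k3 * \<phi> (axis 3 1) ! 1 + k4 * \<phi> (axis 4 1) ! 1 = 0"
    "k0 * \<phi> (axis 0 1) ! 2 + k3 * \<phi> (axis 3 1) ! 2 + k4 * \<phi> (axis 4 1) ! 2 = 0"
    using three_vectors_dependent[of "\<phi> (axis 0 1) ! 1" "\<phi> (axis 3 1) ! 1" "\<phi> (axis 4 1) ! 1"
        "\<phi> (axis 0 1) ! 2" "\<phi> (axis 3 1) ! 2" "\<phi> (axis 4 1) ! 2"] by metis
  define s where "s = [k0, 0, 0, k3, k4, 0, 0, 0, 0]"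
  have s: "s \<in> \<Gamma>_sub n" "bpart s = 0" by (simp_all add: s_def \<Gamma>_sub_iff bpart_def complex_eq_iff)
  have "bpart (\<phi> s) = of_int k0 * bpart (\<phi> (axis 0 1)) + of_int k3 * bpart (\<phi> (axis 3 1)) + of_int k4 * bpart (\<phi> (axis 4 1))"
    using phi_linear[of bpart, OF _ s(1)] by (simp add: s_def)
  also have "\<dots> = 0"
    using k(2,3) by (simp add: bpart_def complex_eq_iff flip: of_int_mult of_int_add)
  finally have "bpart (\<phi> s) = 0" .
  moreover have "bracket (\<phi> x) (\<phi> s) = \<one>\<^bsub>\<Gamma>\<^esub>"
    unfolding bracket_phi_eq_one_iff[OF x(1) s(1)] using x(2) s(2) by (simp add: bracket_eq_one_iff)
  ultimately have "central (\<phi> s)"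
    using y by (simp add: bracket_eq_one_iff central_def)
  then have "central s" using central_phi_iff s by simp
  then show False using k(1) by (simp add: central_def s_def apart_def cpart_def complex_eq_iff)
qed

lemma bpart_phi:
  assumes "x \<in> \<Gamma>_sub n"
  shows "bpart (\<phi> x) = of_int (x!1) * bpart (\<phi> (axis 1 1)) + of_int (x!2 div int n) * bpart (\<phi> (axis 2 (int n)))"
  using phi_linear[of bpart, OF _ assms] by (simp add: bpart_phi_eq_0 axis_in_sub)

lemma preimage:
  assumes "y \<in> \<Gamma>_sub n"
  obtains x where "x \<in> \<Gamma>_sub n" "\<phi> x = y"
  using bij_betw_imp_surj_on[OF bij] assms by (metis imageE)

text \<open>By surjectivity the images of \<open>1\<close> and \<open>n i\<close> generate the \<open>b\<close>-lattice, which has rank 2.\<close>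
lemma p_nonzero: "bpart (\<phi> (axis 1 1)) \<noteq> 0"
proof
  assume 0: "bpart (\<phi> (axis 1 1)) = 0"
  obtain h where h: "h \<in> \<Gamma>_sub n" "\<phi> h = axis 1 1" using preimage[OF axis_in_sub[of 1 1]] by auto
  obtain h' where h': "h' \<in> \<Gamma>_sub n" "\<phi> h' = axis 2 (int n)" using preimage axis2_in_sub[of n 1] by auto
  define t t' p' where "t = h!2 div int n" and "t' = h'!2 div int n" and "p' = bpart (\<phi> (axis 2 (int n)))"
  have 1: "1 = of_int t * p'" "\<i> * of_nat n = of_int t' * p'"
    using bpart_phi[OF h(1)] bpart_phi[OF h'(1)] 0 h h' by (simp_all add: t_def t'_def p'_def)
  then have "of_int t' = of_int t * (\<i> * of_nat n)"
    by (metis mult.left_commute mult.right_neutral)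
  then have "t = 0" using n by (simp add: complex_eq_iff)
  then show False using 1 by simp
qed

lemma n_div [simp]: "int n div int n = 1"
  using n by simp

text \<open>Everything follows from applying \<open>\<phi>\<close> to \<open>[c, n i] = [n i c, 1]\<close> for \<open>c = 1\<close> and \<open>c = i\<close>. If
  \<open>\<alpha>\<close>, \<open>\<beta>\<close> are the \<open>a\<close>-coordinates of the images of these two \<open>c\<close>, and \<open>p\<close> is the \<open>b\<close>-coordinate of the
  image of \<open>1\<close>, the entries \<open>u\<close> give \<open>n p (\<alpha>\<^sup>2 + \<beta>\<^sup>2) = 0\<close>; so the set \<open>a = b = 0\<close> is preserved too.
  The entry \<open>z\<close> relates the actions
  on \<open>b\<close> and \<open>c\<close>.\<close>
lemma apart_phi_34: "apart (\<phi> (axis 3 1)) = 0" "apart (\<phi> (axis 4 1)) = 0"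
  and cpart_phi_34: "cpart (\<phi> (axis 3 1)) * bpart (\<phi> (axis 2 (int n))) = of_nat n * cpart (\<phi> (axis 4 1)) * bpart (\<phi> (axis 1 1))"
    "cpart (\<phi> (axis 4 1)) * bpart (\<phi> (axis 2 (int n))) = - of_nat n * cpart (\<phi> (axis 3 1)) * bpart (\<phi> (axis 1 1))"
proof -
  have H: "axis 1 1 \<in> \<Gamma>_sub n" "axis 2 (int n) \<in> \<Gamma>_sub n" "axis 3 1 \<in> \<Gamma>_sub n" "axis 4 1 \<in> \<Gamma>_sub n"
    "axis 4 (int n) \<in> \<Gamma>_sub n" "axis 3 (- int n) \<in> \<Gamma>_sub n"
    by (simp_all add: \<Gamma>_sub_iff)
  have B0: "bpart (\<phi> (axis 3 k)) = 0" "bpart (\<phi> (axis 4 k)) = 0" for k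
    by (simp_all add: bpart_phi_eq_0 axis_in_sub)
  have lin: "f (\<phi> (axis 4 (int n))) = of_nat n * f (\<phi> (axis 4 1))"
    "f (\<phi> (axis 3 (- int n))) = - of_nat n * f (\<phi> (axis 3 1))" if "f \<in> {apart, bpart, cpart}" for f
    using phi_linear[OF that H(5)] phi_linear[OF that H(6)] by simp_all
  have "bracket (axis 3 1) (axis 2 (int n)) = bracket (axis 4 (int n)) (axis 1 1)"
    by (simp add: bracket_eq_iff)
  then have "bracket (\<phi> (axis 3 1)) (\<phi> (axis 2 (int n))) = bracket (\<phi> (axis 4 (int n))) (\<phi> (axis 1 1))"
    using H by (metis phi_bracket)
  then have 1: "apart (\<phi> (axis 3 1)) * bpart (\<phi> (axis 2 (int n))) = of_nat n * apart (\<phi> (axis 4 1)) * bpart (\<phi> (axis 1 1))"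
    "cpart (\<phi> (axis 3 1)) * bpart (\<phi> (axis 2 (int n))) = of_nat n * cpart (\<phi> (axis 4 1)) * bpart (\<phi> (axis 1 1))"
    by (simp_all add: bracket_eq_iff B0 lin mult_ac)
  have "bracket (axis 4 1) (axis 2 (int n)) = bracket (axis 3 (- int n)) (axis 1 1)"
    by (simp add: bracket_eq_iff complex_eq_iff)
  then have "bracket (\<phi> (axis 4 1)) (\<phi> (axis 2 (int n))) = bracket (\<phi> (axis 3 (- int n))) (\<phi> (axis 1 1))"
    using H by (metis phi_bracket)
  then have 2: "apart (\<phi> (axis 4 1)) * bpart (\<phi> (axis 2 (int n))) = - of_nat n * apart (\<phi> (axis 3 1)) * bpart (\<phi> (axis 1 1))"
    "cpart (\<phi> (axis 4 1)) * bpart (\<phi> (axis 2 (int n))) = - of_nat n * cpart (\<phi> (axis 3 1)) * bpart (\<phi> (axis 1 1))"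
    by (simp_all add: bracket_eq_iff B0 lin mult_ac) (metis minus_minus)
  show "cpart (\<phi> (axis 3 1)) * bpart (\<phi> (axis 2 (int n))) = of_nat n * cpart (\<phi> (axis 4 1)) * bpart (\<phi> (axis 1 1))"
    "cpart (\<phi> (axis 4 1)) * bpart (\<phi> (axis 2 (int n))) = - of_nat n * cpart (\<phi> (axis 3 1)) * bpart (\<phi> (axis 1 1))"
    by (fact 1 2)+
  define a a' where "a = \<phi> (axis 3 1) ! 0" and "a' = \<phi> (axis 4 1) ! 0"
  have "of_nat n * bpart (\<phi> (axis 1 1)) * (apart (\<phi> (axis 3 1)) ^ 2 + apart (\<phi> (axis 4 1)) ^ 2) = 0"
  proof -
    have "of_nat n * bpart (\<phi> (axis 1 1)) * (apart (\<phi> (axis 3 1)) ^ 2 + apart (\<phi> (axis 4 1)) ^ 2) =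
      apart (\<phi> (axis 4 1)) * (of_nat n * apart (\<phi> (axis 4 1)) * bpart (\<phi> (axis 1 1))) -
      apart (\<phi> (axis 3 1)) * (- of_nat n * apart (\<phi> (axis 3 1)) * bpart (\<phi> (axis 1 1)))"
      by (simp add: power2_eq_square algebra_simps)
    also have "\<dots> = 0"
      unfolding 1(1)[symmetric] 2(1)[symmetric] by simp
    finally show ?thesis .
  qed
  then have "apart (\<phi> (axis 3 1)) ^ 2 + apart (\<phi> (axis 4 1)) ^ 2 = 0"
    using n p_nonzero by simp
  then have "of_int (a\<^sup>2 + a'\<^sup>2) = (0 :: complex)"
    by (simp add: apart_def a_def a'_def)
  then have "a\<^sup>2 + a'\<^sup>2 = 0"
    by (simp only: of_int_eq_0_iff)
  then show "apart (\<phi> (axis 3 1)) = 0" "apart (\<phi> (axis 4 1)) = 0"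
    by (simp_all add: apart_def a_def a'_def sum_power2_eq_zero_iff)
qed

text \<open>Let \<open>p\<close>, \<open>p'\<close> be the images of \<open>1\<close>, \<open>n i\<close> in the \<open>b\<close>-lattice. Eliminating the action on \<open>c\<close>
  gives \<open>p'\<^sup>2 = (n i p)\<^sup>2\<close>, so \<open>p' = s n i p\<close> for a sign \<open>s\<close>. As 1 is in the image,
  \<open>p * (x + s n y i) = 1\<close> for integers \<open>x\<close>, \<open>y\<close>, so \<open>p\<close> is a Gaussian unit. But \<open>n\<close> divides the
  imaginary part of \<open>p\<close>, which rules out the units \<open>i\<close> and \<open>-i\<close>.\<close>
lemma phi_b_signs:
  obtains e s :: int where "e \<in> {1, -1}" "s \<in> {1, -1}"
    "bpart (\<phi> (axis 1 1)) = of_int e" "bpart (\<phi> (axis 2 (int n))) = of_int (e * s * int n) * \<i>"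
    "cpart (\<phi> (axis 4 1)) = of_int s * \<i> * cpart (\<phi> (axis 3 1))"
proof -
  define p p' q q' where "p = bpart (\<phi> (axis 1 1))" and "p' = bpart (\<phi> (axis 2 (int n)))"
    and "q = cpart (\<phi> (axis 3 1))" and "q' = cpart (\<phi> (axis 4 1))"
  have p: "p \<noteq> 0" using p_nonzero by (simp add: p_def)
  have q: "q \<noteq> 0"
  proof
    assume "q = 0"
    then have "central (\<phi> (axis 3 1))"
      by (simp add: central_def apart_phi_34 q_def bpart_phi_eq_0 axis_in_sub)
    then show False
      using central_phi_iff[of "axis 3 1"] by (simp add: axis_in_sub central_def)
  qed
  have rel: "q * p' = of_nat n * q' * p" "q' * p' = - of_nat n * q * p"
    using cpart_phi_34 by (simp_all add: p_def p'_def q_def q'_def)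
  then have "q * (p'\<^sup>2 - (\<i> * of_nat n * p)\<^sup>2) = 0"
  proof -
    have "q * (p'\<^sup>2 - (\<i> * of_nat n * p)\<^sup>2) = (q * p') * p' - of_nat n * p * (- of_nat n * q * p)"
      by (simp add: power_mult_distrib) (simp add: power2_eq_square algebra_simps)
    also have "\<dots> = of_nat n * p * (q' * p') - of_nat n * p * (- of_nat n * q * p)"
      unfolding rel(1) by (simp add: mult_ac)
    finally show ?thesis by (simp add: rel(2))
  qed
  then have "p'\<^sup>2 = (\<i> * of_nat n * p)\<^sup>2"
    using q by simp
  then have "p' = \<i> * of_nat n * p \<or> p' = - (\<i> * of_nat n * p)"
    by (simp only: power2_eq_iff)
  then obtain s :: int where s: "s \<in> {1, -1}" "p' = of_int s * (\<i> * of_nat n * p)"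
  proof
    assume "p' = \<i> * of_nat n * p" then show thesis by (intro that[of 1]) simp_all
  next
    assume "p' = - (\<i> * of_nat n * p)" then show thesis by (intro that[of "-1"]) simp_all
  qed
  have "of_nat n * p * q' = of_nat n * p * (of_int s * \<i> * q)"
    using rel(1) s(2) by (auto simp: mult_ac)
  then have q': "q' = of_int s * \<i> * q"
    using n p by simp
  obtain h where h: "h \<in> \<Gamma>_sub n" "\<phi> h = axis 1 1"
    using preimage[OF axis_in_sub[of 1 1]] by auto
  define x y where "x = h!1" and "y = h!2 div int n"
  have "1 = of_int x * p + of_int y * p'"
    using bpart_phi[OF h(1)] h(2) by (simp add: x_def y_def p_def p'_def)
  then have "p * Complex (of_int x) (of_int (s * int n * y)) = 1"
    using s(2) by (simp add: complex_eq_iff algebra_simps)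
  then have "(cmod p)\<^sup>2 * (cmod (Complex (of_int x) (of_int (s * int n * y))))\<^sup>2 = 1"
    by (metis norm_mult norm_one one_power2 power_mult_distrib)
  then have "real_of_int (((\<phi> (axis 1 1) ! 1)\<^sup>2 + (\<phi> (axis 1 1) ! 2)\<^sup>2) * (x\<^sup>2 + (s * int n * y)\<^sup>2)) = 1"
    by (simp add: cmod_power2 p_def bpart_def)
  then have *: "((\<phi> (axis 1 1) ! 1)\<^sup>2 + (\<phi> (axis 1 1) ! 2)\<^sup>2) * (x\<^sup>2 + (s * int n * y)\<^sup>2) = 1"
    by (simp only: of_int_eq_1_iff)
  then have norm: "(\<phi> (axis 1 1) ! 1)\<^sup>2 + (\<phi> (axis 1 1) ! 2)\<^sup>2 = 1"
    by (simp add: zmult_eq_1_iff) (smt (verit) zero_le_power2)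
  have "int n dvd \<phi> (axis 1 1) ! 2"
    using closed[of "axis 1 1"] by (simp add: \<Gamma>_sub_iff)
  then have z: "\<phi> (axis 1 1) ! 2 = 0"
  proof (rule contrapos_pp)
    assume nz: "\<phi> (axis 1 1) ! 2 \<noteq> 0"
    have "\<bar>\<phi> (axis 1 1) ! 2\<bar> \<le> 1"
      using norm by (metis abs_square_le_1 le_add_same_cancel2 zero_le_power2)
    then show "\<not> int n dvd \<phi> (axis 1 1) ! 2"
      using nz n dvd_imp_le_int[of "\<phi> (axis 1 1) ! 2" "int n"] by linarith
  qed
  define e where "e = \<phi> (axis 1 1) ! 1"
  have "p = of_int e" using z by (simp add: p_def bpart_def e_def complex_eq_iff)
  moreover have "e \<in> {1, -1}"
    using norm z by (simp add: e_def power2_eq_1_iff)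
  ultimately show ?thesis
    using s q' by (intro that[of e s]) (simp_all add: p_def p'_def q_def q'_def mult_ac)
qed

lemma phi_central_u:
  assumes w: "w \<in> \<Gamma>_sub n" "central w"
  shows "\<phi> w ! 5 = w!5 * \<phi> (axis 5 1) ! 5 + w!6 * \<phi> (axis 6 1) ! 5 + w!7 * \<phi> (axis 7 1) ! 5 + w!8 * \<phi> (axis 8 1) ! 5"
proof -
  have cen: "central (axis i k)" "axis i k \<in> \<Gamma>_sub n" if "i \<in> {5..<9}" for i k
    using that by (auto simp: central_def apart_def bpart_def cpart_def complex_eq_iff axis_in_sub)
  have 0: "\<phi> x ! 0 = 0" if "x \<in> \<Gamma>_sub n" "central x" for x
    using central_phi_iff[OF that(1)] that by (simp add: central_def apart_eq_0_iff)
  have add: "\<phi> (gmult x y) ! 5 = \<phi> x ! 5 + \<phi> y ! 5" if "x \<in> \<Gamma>_sub n" "central x" "y \<in> \<Gamma>_sub n" for x y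
    using that by (simp add: phi_gmult 0)
  have ax: "\<phi> (axis i k) ! 5 = k * \<phi> (axis i 1) ! 5" if "i \<in> {5..<9}" for i k
    using additive_int[of "\<lambda>k. \<phi> (axis i k) ! 5" k] that
    by (simp add: axis_add add cen)
  have "w = gmult (axis 5 (w!5)) (gmult (axis 6 (w!6)) (gmult (axis 7 (w!7)) (axis 8 (w!8))))"
    using w by (intro list9_eqI) (simp_all add: central_def apart_eq_0_iff bpart_eq_0_iff cpart_eq_0_iff len)
  then have "\<phi> w ! 5 = \<phi> (gmult (axis 5 (w!5)) (gmult (axis 6 (w!6)) (gmult (axis 7 (w!7)) (axis 8 (w!8))))) ! 5"
    by simp
  also have "\<dots> = \<phi> (axis 5 (w!5)) ! 5 + (\<phi> (axis 6 (w!6)) ! 5 + (\<phi> (axis 7 (w!7)) ! 5 + \<phi> (axis 8 (w!8)) ! 5))"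
    by (simp add: add cen gmult_in_sub)
  also have "\<dots> = w!5 * \<phi> (axis 5 1) ! 5 + w!6 * \<phi> (axis 6 1) ! 5 + w!7 * \<phi> (axis 7 1) ! 5 + w!8 * \<phi> (axis 8 1) ! 5"
    using ax[of 5 "w!5"] ax[of 6 "w!6"] ax[of 7 "w!7"] ax[of 8 "w!8"] by simp
  finally show ?thesis .
qed

text \<open>The set \<open>b = 0\<close> modulo the set \<open>a = b = 0\<close> is infinite cyclic, and \<open>\<phi>\<close> induces an automorphism
  of it.\<close>
lemma phi_a_sign:
  obtains d :: int where "d \<in> {1, -1}" "\<forall>x\<in>\<Gamma>_sub n. bpart x = 0 \<longrightarrow> apart (\<phi> x) = of_int d * apart x"
proof -
  define d where "d = \<phi> (axis 0 1) ! 0"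
  have d: "apart (\<phi> x) = of_int d * apart x" if "x \<in> \<Gamma>_sub n" "bpart x = 0" for x
  proof -
    have "apart (\<phi> x) = of_int (x!0) * apart (\<phi> (axis 0 1))"
      using phi_linear[of apart, OF _ that(1)] that(2) by (simp add: apart_phi_34 bpart_eq_0_iff)
    then show ?thesis by (simp add: apart_def d_def)
  qed
  obtain h where h: "h \<in> \<Gamma>_sub n" "\<phi> h = axis 0 1"
    using preimage[OF axis_in_sub[of 0 1]] by auto
  obtain e s :: int where es: "e \<in> {1, -1}" "s \<in> {1, -1}"
    "bpart (\<phi> (axis 1 1)) = of_int e" "bpart (\<phi> (axis 2 (int n))) = of_int (e * s * int n) * \<i>"
    by (rule phi_b_signs)
  have "bpart h = 0"
  proof -
    have "h!1 = 0" "h!2 div int n = 0"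
      using bpart_phi[OF h(1)] es h(2) n by (auto simp: complex_eq_iff)
    then show ?thesis using h(1) by (auto simp: bpart_eq_0_iff \<Gamma>_sub_iff dvd_div_eq_0_iff)
  qed
  then have "of_int (d * h!0) = (1 :: complex)"
    using d[OF h(1)] h(2) by (simp add: apart_def)
  then have "d * h!0 = 1"
    by (simp only: of_int_eq_1_iff)
  then have "d \<in> {1, -1}" by (auto simp: zmult_eq_1_iff)
  then show ?thesis using d that by blast
qed

section \<open>Infinitely many twisted conjugacy classes\<close>

text \<open>The signs of \<open>\<phi>\<close> are \<open>e\<close> and \<open>e * s\<close> on the two axes of \<open>b\<close>, \<open>d\<close> on \<open>a\<close>, and \<open>d * e\<close> on the real
  axis of \<open>u\<close>. The layers, from the top, are \<open>b\<close>, \<open>a\<close>, \<open>c\<close> and \<open>u\<close>. If \<open>z\<close> is a twisted conjugator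
  between two elements of a layer, then \<open>\<phi>\<close> fixes the coordinates of \<open>z\<close> in the layers above; so these
  vanish if 1 is not an eigenvalue there. In the
  coordinate of eigenvalue 1 the contributions of \<open>z\<close> and \<open>\<phi> z\<close> then cancel. The only layer in
  which \<open>\<phi>\<close> need not act by signs is \<open>c\<close>: for \<open>s = 1\<close> it acts there as
  multiplication by a Gaussian integer \<open>q\<close>, which has the eigenvalue 1 only for \<open>q = 1\<close>.\<close>
lemma infinite_classes: "infinite (\<Gamma>_sub n // twisted_conj (\<Gamma>\<lparr>carrier := \<Gamma>_sub n\<rparr>) \<phi>)"
proof -
  have sub: "subgroup (\<Gamma>_sub n) \<Gamma>" using index_\<Gamma>_sub n by simp
  interpret H: group "\<Gamma>\<lparr>carrier := \<Gamma>_sub n\<rparr>"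
    by (rule \<Gamma>.subgroup_imp_group[OF sub])
  have infI: "infinite (\<Gamma>_sub n // twisted_conj (\<Gamma>\<lparr>carrier := \<Gamma>_sub n\<rparr>) \<phi>)"
    if x: "\<And>k. x k \<in> \<Gamma>_sub n"
      and ne: "\<And>k l z. z \<in> \<Gamma>_sub n \<Longrightarrow> gmult (x l) (\<phi> z) = gmult z (x k) \<Longrightarrow> k = l" for x :: "nat \<Rightarrow> int list"
  proof (rule infinite_quotientI[where x = x])
    show "equiv (\<Gamma>_sub n) (twisted_conj (\<Gamma>\<lparr>carrier := \<Gamma>_sub n\<rparr>) \<phi>)"
      using H.equiv_twisted_conj[OF aut] by simp
    fix k l assume "(x k, x l) \<in> twisted_conj (\<Gamma>\<lparr>carrier := \<Gamma>_sub n\<rparr>) \<phi>"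
    then obtain z where "z \<in> \<Gamma>_sub n" "gmult (x l) (\<phi> z) = gmult z (x k)"
      unfolding H.twisted_conj_iff[OF aut] by auto
    then show "k = l" by (rule ne)
  qed (rule x)
  obtain e s :: int where es: "e \<in> {1, -1}" "s \<in> {1, -1}"
    "bpart (\<phi> (axis 1 1)) = of_int e" "bpart (\<phi> (axis 2 (int n))) = of_int (e * s * int n) * \<i>"
    "cpart (\<phi> (axis 4 1)) = of_int s * \<i> * cpart (\<phi> (axis 3 1))"
    by (rule phi_b_signs)
  obtain d :: int where d: "d \<in> {1, -1}" "\<forall>x\<in>\<Gamma>_sub n. bpart x = 0 \<longrightarrow> apart (\<phi> x) = of_int d * apart x"
    by (rule phi_a_sign)
  have apart_phi: "apart (\<phi> x) = of_int d * apart x" if "x \<in> \<Gamma>_sub n" "bpart x = 0" for x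
    using d(2) that by blast
  have b_signs: "bpart (\<phi> z) = of_int e * Complex (of_int (z!1)) (of_int (s * z!2))" if "z \<in> \<Gamma>_sub n" for z
  proof -
    have "z!2 = int n * (z!2 div int n)" using that by (simp add: \<Gamma>_sub_iff)
    then have "real_of_int (z!2) = of_nat n * of_int (z!2 div int n)"
      by (metis of_int_mult of_int_of_nat_eq)
    then show ?thesis
      using bpart_phi[OF that] es by (simp add: complex_eq_iff)
  qed
  define q where "q = cpart (\<phi> (axis 3 1))"
  consider "e = 1" | "e = -1" "s = -1" | "e = -1" "s = 1" "d = 1" | "e = -1" "s = 1" "d = -1" "q = 1"
    | "e = -1" "s = 1" "d = -1" "q \<noteq> 1"
    using es d by auto
  moreover have cpart_phi: "cpart (\<phi> z) = q * cpart z" if "z \<in> \<Gamma>_sub n" "apart z = 0" "bpart z = 0" "s = 1" for z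
  proof -
    have "cpart (\<phi> z) = of_int (z!3) * q + of_int (z!4) * (\<i> * q)"
      using phi_linear[of cpart, OF _ that(1)] that(2-4) es(5) by (simp add: apart_eq_0_iff bpart_eq_0_iff q_def)
    then show ?thesis by (simp add: cpart_def[of z] complex_eq_iff)
  qed
  \<comment> \<open>The real axis of \<open>u\<close> is spanned by \<open>[a, b\<^sub>1]\<close>, so its image has the sign \<open>d * e\<close>; the commutators
    spanning the other central coordinates have images with vanishing entry 5.\<close>
  moreover have u_phi: "\<phi> w ! 5 = d * e * w ! 5" if w: "w \<in> \<Gamma>_sub n" "central w" for w
  proof -
    have H: "axis 0 1 \<in> \<Gamma>_sub n" "axis (Suc 0) 1 \<in> \<Gamma>_sub n" "axis 2 (int n) \<in> \<Gamma>_sub n" "axis 3 1 \<in> \<Gamma>_sub n" "axis 4 1 \<in> \<Gamma>_sub n"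
      by (simp_all add: \<Gamma>_sub_iff)
    have B0: "\<phi> (axis i 1) ! Suc 0 = 0" if "i \<in> {0, 3, 4}" for i
    proof -
      have "bpart (\<phi> (axis i 1)) = 0"
        using that by (intro bpart_phi_eq_0) (auto simp: axis_in_sub)
      then show ?thesis by (simp add: bpart_eq_0_iff)
    qed
    have A0: "\<phi> (axis 3 1) ! 0 = 0" "\<phi> (axis 4 1) ! 0 = 0"
      using apart_phi_34 by (simp_all add: apart_eq_0_iff)
    have "apart (\<phi> (axis 0 1)) = of_int d" using apart_phi[OF H(1)] by simp
    then have a: "\<phi> (axis 0 1) ! 0 = d" by (simp add: apart_def)
    have b: "\<phi> (axis (Suc 0) 1) ! Suc 0 = e" "\<phi> (axis 2 (int n)) ! Suc 0 = 0"
      using es(3,4) by (auto simp: bpart_def complex_eq_iff)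
    have brackets: "bracket (axis 0 1) (axis 1 1) = axis 5 1" "bracket (axis 0 1) (axis 2 (int n)) = axis 6 (int n)"
      "bracket (axis 1 1) (axis 3 1) = axis 7 1" "bracket (axis 1 1) (axis 4 1) = axis 8 1"
      by (rule list9_eqI; simp add: bracket_def)+
    have bracket5: "bracket x y ! 5 = x!0 * y!1 - y!0 * x!1" for x y
      by (simp add: bracket_def)
    have gen: "\<phi> (axis 5 1) ! 5 = d * e" "\<phi> (axis 6 (int n)) ! 5 = 0"
      "\<phi> (axis 7 1) ! 5 = 0" "\<phi> (axis 8 1) ! 5 = 0"
      unfolding brackets[symmetric] by (simp_all add: phi_bracket H bracket5 B0 A0 a b)
    \<comment> \<open>The basis vector of index 6 is no commutator in the subgroup, but its \<open>n\<close>-th power is.\<close>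
    have "central (axis 6 (int n))"
      by (simp add: central_def apart_def bpart_def cpart_def complex_eq_iff)
    then have "int n * \<phi> (axis 6 1) ! 5 = 0"
      using phi_central_u[of "axis 6 (int n)"] gen(2) by (simp add: axis_in_sub)
    then have "\<phi> (axis 6 1) ! 5 = 0" using n by simp
    then show ?thesis
      using phi_central_u[OF w] gen by simp
  qed
  ultimately show ?thesis
  proof cases
    case 1
    show ?thesis
    proof (rule infI[of "\<lambda>k. axis 1 (int k)"])
      fix k l z assume z: "z \<in> \<Gamma>_sub n" "gmult (axis 1 (int l)) (\<phi> z) = gmult z (axis 1 (int k))"
      have "bpart (axis 1 (int l)) + bpart (\<phi> z) = bpart z + bpart (axis 1 (int k))"
        using arg_cong[OF z(2), of bpart] by simp
      then show "k = l" using 1 b_signs[OF z(1)] by (simp add: bpart_def complex_eq_iff)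
    qed (simp add: axis_in_sub)
  next
    case 2
    show ?thesis
    proof (rule infI[of "\<lambda>k. axis 2 (int n * int k)"])
      fix k l z assume z: "z \<in> \<Gamma>_sub n" "gmult (axis 2 (int n * int l)) (\<phi> z) = gmult z (axis 2 (int n * int k))"
      have "bpart (axis 2 (int n * int l)) + bpart (\<phi> z) = bpart z + bpart (axis 2 (int n * int k))"
        using arg_cong[OF z(2), of bpart] by simp
      then show "k = l" using 2 n b_signs[OF z(1)] by (simp add: bpart_def complex_eq_iff)
    qed (simp add: axis2_in_sub)
  next
    case 3
    show ?thesis
    proof (rule infI[of "\<lambda>k. axis 0 (int k)"])
      fix k l z assume z: "z \<in> \<Gamma>_sub n" "gmult (axis 0 (int l)) (\<phi> z) = gmult z (axis 0 (int k))"
      have "bpart (\<phi> z) = bpart z"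
        using arg_cong[OF z(2), of bpart] by simp
      then have "bpart z = 0" using 3 b_signs[OF z(1)] by (simp add: bpart_def complex_eq_iff)
      then have "apart (\<phi> z) = apart z" using apart_phi[OF z(1)] 3 by simp
      then show "k = l" using arg_cong[OF z(2), of apart] by simp
    qed (simp add: axis_in_sub)
  next
    case 4
    show ?thesis
    proof (rule infI[of "\<lambda>k. axis 3 (int k)"])
      fix k l z assume z: "z \<in> \<Gamma>_sub n" "gmult (axis 3 (int l)) (\<phi> z) = gmult z (axis 3 (int k))"
      have "bpart (\<phi> z) = bpart z"
        using arg_cong[OF z(2), of bpart] by simp
      then have bz: "bpart z = 0" using 4 b_signs[OF z(1)] by (simp add: bpart_def complex_eq_iff)
      have "apart (\<phi> z) = apart z" using arg_cong[OF z(2), of apart] by simp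
      then have "apart z = 0" using apart_phi[OF z(1) bz] 4 by simp
      then have "cpart (\<phi> z) = cpart z" using cpart_phi[OF z(1) _ bz] 4 by simp
      then show "k = l" using arg_cong[OF z(2), of cpart] by simp
    qed (simp add: axis_in_sub)
  next
    case 5
    show ?thesis
    proof (rule infI[of "\<lambda>k. axis 5 (int k)"])
      fix k l z assume z: "z \<in> \<Gamma>_sub n" "gmult (axis 5 (int l)) (\<phi> z) = gmult z (axis 5 (int k))"
      have axis5_parts: "apart (axis 5 j) = 0" "bpart (axis 5 j) = 0" "cpart (axis 5 j) = 0" for j
        by (simp_all add: apart_def bpart_def cpart_def complex_eq_iff)
      have "bpart (\<phi> z) = bpart z"
        using arg_cong[OF z(2), of bpart] by (simp add: axis5_parts)
      then have bz: "bpart z = 0" using 5 b_signs[OF z(1)] by (simp add: bpart_def complex_eq_iff)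
      have "apart (\<phi> z) = apart z" using arg_cong[OF z(2), of apart] by (simp add: axis5_parts)
      then have az: "apart z = 0" using apart_phi[OF z(1) bz] 5 by simp
      have "cpart (\<phi> z) = cpart z" using arg_cong[OF z(2), of cpart] by (simp add: axis5_parts)
      then have "cpart z = 0" using cpart_phi[OF z(1) az bz] 5 by simp
      then have "\<phi> z ! 5 = z ! 5" using u_phi[OF z(1)] az bz 5 by (simp add: central_def)
      moreover have "gmult (axis 5 (int l)) (\<phi> z) ! 5 = gmult z (axis 5 (int k)) ! 5"
        using z(2) by simp
      ultimately show "k = l" by simp
    qed (simp add: axis_in_sub)
  qed
qed

end

lemma R_infinity_\<Gamma>_sub:
  assumes "n \<ge> 2"
  shows "R_infinity (\<Gamma>\<lparr>carrier := \<Gamma>_sub n\<rparr>)"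
proof -
  have "infinite (\<Gamma>_sub n // twisted_conj (\<Gamma>\<lparr>carrier := \<Gamma>_sub n\<rparr>) \<phi>)"
    if "\<phi> \<in> auto (\<Gamma>\<lparr>carrier := \<Gamma>_sub n\<rparr>)" for \<phi>
    using \<Gamma>_sub_automorphism.infinite_classes[OF \<Gamma>_sub_automorphism.intro[OF assms that]] .
  then show ?thesis
    using \<Gamma>.subgroup_imp_group[OF index_\<Gamma>_sub(1)] assms by (simp add: R_infinity_def)
qed

theorem theorem1p2:
  shows "\<exists>G :: int list monoid.
    group G \<and> finitely_generated_group G \<and> torsion_free_group G \<and> nilpotent_of_class G 2 \<and>
    \<not> R_infinity G \<and>
    (\<forall>n::nat. n \<ge> 2 \<longrightarrow>
      (\<exists>H. subgroup H G \<and> card (rcosets\<^bsub>G\<^esub> H) = n \<and> R_infinity (G\<lparr>carrier := H\<rparr>)))"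
proof (intro exI[of _ \<Gamma>] conjI allI impI)
  fix n :: nat assume "n \<ge> 2"
  then show "\<exists>H. subgroup H \<Gamma> \<and> card (rcosets\<^bsub>\<Gamma>\<^esub> H) = n \<and> R_infinity (\<Gamma>\<lparr>carrier := H\<rparr>)"
    by (intro exI[of _ "\<Gamma>_sub n"] conjI index_\<Gamma>_sub R_infinity_\<Gamma>_sub) simp_all
qed (fact group_\<Gamma> finitely_generated_\<Gamma> torsion_free_\<Gamma> nilpotent_\<Gamma> not_R_infinity_\<Gamma>)+

end
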